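(* Let $L$ be an arbitrary complete lattice. There is a bijection between the set of idempotent join-continuous maps $f : L \to L$ (those with $f \circ f = f$) and the set of emmentalers of $L$.
   Context: A map $f : L \to L$ on a complete lattice is join-continuous if $f(\bigvee X) = \bigvee f(X)$ for every subset $X \subseteq L$ (including $X=\emptyset$). An emmentaler of a complete lattice $L$ is a collection $\mathcal{E} = \{[y_i,x_i] \mid i \in I\}$ of closed intervals of $L$ (with $y_i \leq x_i$, where $[y,x] = \{z \in L \mid y \leq z \leq x\}$) such that: (1) $[y_i,x_i] \cap [y_j,x_j] = \emptyset$ for $i,j \in I$ with $i \neq j$; (2) $\{y_i \mid i \in I\}$ is a subset of $L$ closed under arbitrary joins (including the empty join); (3) $\{x_i \mid i \in I\}$ is a subset of $L$ closed under arbitrary meets (including the empty meet). *)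

theory Defs
  imports "HOL-Library.Disjoint_Sets"
begin

text \<open>
  The library predicate \<open>sup_continuous\<close> only concerns suprema of increasing chains, so it is not
  the notion needed here: all subsets are admitted, the empty one included.
\<close>

definition join_continuous :: "('a::complete_lattice \<Rightarrow> 'a) \<Rightarrow> bool" where
  "join_continuous f \<longleftrightarrow> (\<forall>X. f (Sup X) = Sup (f ` X))"

text \<open>
  An emmentaler is a set of intervals, not a family of them. The index set is taken to be the set
  \<open>P\<close> of the endpoint pairs \<open>(y, x)\<close>. This is no restriction: since \<open>y i \<le> x i\<close>, the intervals are
  nonempty, so in a family that is pairwise disjoint for distinct indices, the index \<open>i\<close> is
  determined by the pair \<open>(y i, x i)\<close>. The subset \<open>S = {}\<close> is admitted in both closure conditions.
\<close>

definition emmentaler :: "'a::complete_lattice set set \<Rightarrow> bool" where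
  "emmentaler E \<longleftrightarrow>
    (\<exists>P. E = (\<lambda>(y, x). {y..x}) ` P \<and>
         (\<forall>(y, x)\<in>P. y \<le> x) \<and>
         disjoint_family_on (\<lambda>(y, x). {y..x}) P \<and>
         (\<forall>S \<subseteq> fst ` P. Sup S \<in> fst ` P) \<and>
         (\<forall>S \<subseteq> snd ` P. Inf S \<in> snd ` P))"

end

theory Submission
  imports Defs
begin

text \<open>
  A join-continuous \<open>f\<close> has a right adjoint \<open>g\<close>. If \<open>f\<close> is idempotent, it is sent to the emmentaler
  of the intervals \<open>[y, g y]\<close> with \<open>y\<close> in the range of \<open>f\<close>; they are disjoint because \<open>f\<close> takes the
  value \<open>y\<close> on all of \<open>[y, g y]\<close>. Conversely, disjointness and the closure conditions force
  \<open>y \<le> y' \<longleftrightarrow> x \<le> x'\<close> for any two intervals \<open>[y, x]\<close> and \<open>[y', x']\<close> of an emmentaler, so that sending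
  \<open>z\<close> to the lower endpoint of the interval with the least upper endpoint above \<open>z\<close> defines a
  map \<open>f\<close> with \<open>f z \<le> y \<longleftrightarrow> z \<le> x\<close>, which recovers the emmentaler.
\<close>

definition right_adjoint :: "('a::complete_lattice \<Rightarrow> 'a) \<Rightarrow> 'a \<Rightarrow> 'a" where
  "right_adjoint f y = Sup {z. f z \<le> y}"

definition range_endpoints :: "('a::complete_lattice \<Rightarrow> 'a) \<Rightarrow> ('a \<times> 'a) set" where
  "range_endpoints f = (\<lambda>y. (y, right_adjoint f y)) ` range f"

definition emmentaler_endpoints :: "('a::complete_lattice \<times> 'a) set \<Rightarrow> bool" where
  "emmentaler_endpoints P \<longleftrightarrow>
    (\<forall>(y, x)\<in>P. y \<le> x) \<and>
    disjoint_family_on (\<lambda>(y, x). {y..x}) P \<and>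
    (\<forall>S \<subseteq> fst ` P. Sup S \<in> fst ` P) \<and>
    (\<forall>S \<subseteq> snd ` P. Inf S \<in> snd ` P)"

lemma emmentaler_iff_endpoints:
  "emmentaler E \<longleftrightarrow> (\<exists>P. E = (\<lambda>(y, x). {y..x}) ` P \<and> emmentaler_endpoints P)"
  unfolding emmentaler_def emmentaler_endpoints_def ..

text \<open>A nonempty closed interval determines its endpoints, so equal sets of intervals come
  from equal sets of endpoint pairs. This is what injectivity needs.\<close>

lemma interval_image_eq_imp_subset:
  fixes P Q :: "('a::order \<times> 'a) set"
  assumes "(\<lambda>(y, x). {y..x}) ` P = (\<lambda>(y, x). {y..x}) ` Q"
    and "\<And>y x. (y, x) \<in> P \<Longrightarrow> y \<le> x"
  shows "P \<subseteq> Q"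
proof (rule subrelI)
  fix y x assume P: "(y, x) \<in> P"
  then have "{y..x} \<in> (\<lambda>(y, x). {y..x}) ` Q"
    unfolding assms(1)[symmetric] by (intro image_eqI[of _ _ "(y, x)"]) simp_all
  then obtain y' x' where "(y', x') \<in> Q" "{y..x} = {y'..x'}"
    by auto
  with assms(2)[OF P] show "(y, x) \<in> Q"
    by (simp add: Icc_eq_Icc)
qed

section \<open>Join-continuous maps and their right adjoints\<close>

lemma join_continuous_mono:
  assumes "join_continuous f"
  shows "mono f"
proof (rule monoI)
  fix x y :: 'a assume "x \<le> y"
  then have "f y = f (Sup {x, y})"
    by (simp add: sup_absorb2)
  also have "\<dots> = Sup (f ` {x, y})"
    using assms unfolding join_continuous_def by blast
  finally show "f x \<le> f y"
    by (simp add: le_iff_sup)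
qed

text \<open>Since \<open>f\<close> preserves the join that defines \<open>right_adjoint f y\<close>,
  the value of \<open>f\<close> there is a join of elements below \<open>y\<close>; monotonicity
  extends this bound to everything below.\<close>

lemma le_right_adjoint_iff:
  assumes "join_continuous f"
  shows "z \<le> right_adjoint f y \<longleftrightarrow> f z \<le> y"
proof
  assume "z \<le> right_adjoint f y"
  then have "f z \<le> f (right_adjoint f y)"
    using join_continuous_mono[OF assms] by (rule monoD[rotated])
  also have "\<dots> = Sup (f ` {z. f z \<le> y})"
    using assms unfolding join_continuous_def right_adjoint_def by blast
  also have "\<dots> \<le> y"
    by (auto intro: Sup_least)
  finally show "f z \<le> y" .
qed (simp add: right_adjoint_def Sup_upper)

lemma right_adjoint_Inf:
  assumes "join_continuous f"
  shows "right_adjoint f (Inf A) = Inf (right_adjoint f ` A)"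
proof -
  have "z \<le> right_adjoint f (Inf A) \<longleftrightarrow> z \<le> Inf (right_adjoint f ` A)" for z
    by (simp add: le_right_adjoint_iff[OF assms] le_Inf_iff)
  then show ?thesis
    by (meson order.antisym order.refl)
qed

text \<open>Ensures that every value of the adjoint is already attained on the range of
  \<open>f\<close>, so that the upper endpoints inherit closure under meets from
  \<open>right_adjoint_Inf\<close>.\<close>

lemma right_adjoint_triple:
  assumes "join_continuous f"
  shows "right_adjoint f (f (right_adjoint f y)) = right_adjoint f y"
proof (rule order.antisym)
  note adj = le_right_adjoint_iff[OF assms]
  have counit: "f (right_adjoint f x) \<le> x" for x
    by (simp flip: adj)
  show "right_adjoint f (f (right_adjoint f y)) \<le> right_adjoint f y"
    unfolding adj by (rule order.trans[OF counit counit])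
qed (simp add: le_right_adjoint_iff[OF assms])

section \<open>From idempotent maps to emmentalers\<close>

lemma emmentaler_endpoints_range_endpoints:
  assumes jc: "join_continuous f" and idem: "f \<circ> f = f"
  shows "emmentaler_endpoints (range_endpoints f)"
proof -
  note adj = le_right_adjoint_iff[OF jc]
  have ff: "f (f z) = f z" for z
    using idem by (metis comp_apply)
  have fst_eq: "fst ` range_endpoints f = range f"
    by (simp add: range_endpoints_def image_image)
  have snd_eq: "snd ` range_endpoints f = range (right_adjoint f)"
  proof
    show "range (right_adjoint f) \<subseteq> snd ` range_endpoints f"
    proof
      fix x assume "x \<in> range (right_adjoint f)"
      then have "x = right_adjoint f (f x)"
        using right_adjoint_triple[OF jc] by auto
      then show "x \<in> snd ` range_endpoints f"
        unfolding range_endpoints_def image_image by simp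
    qed
  qed (auto simp: range_endpoints_def)
  \<comment> \<open>Monotonicity and idempotence give \<open>f z \<le> f w\<close>; the adjunction
    gives the reverse inequality.\<close>
  have const: "f w = f z" if "w \<in> {f z..right_adjoint f (f z)}" for w z
    using that monoD[OF join_continuous_mono[OF jc], of "f z" w]
    by (simp add: adj ff order.antisym)
  \<comment> \<open>By idempotence the range consists of fixed points, and a join of fixed points is
    again fixed.\<close>
  have "Sup S \<in> range f" if "S \<subseteq> range f" for S
  proof -
    have "f (Sup S) = Sup (f ` S)"
      using jc unfolding join_continuous_def by blast
    also have "f ` S = id ` S"
      using that ff by (intro image_cong) auto
    finally have "Sup S = f (Sup S)"
      by simp
    then show ?thesis
      by (rule range_eqI)
  qed
  moreover have "Inf S \<in> range (right_adjoint f)" if "S \<subseteq> range (right_adjoint f)" for S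
    using that right_adjoint_Inf[OF jc] by (metis rangeI subset_imageE)
  moreover have "disjoint_family_on (\<lambda>(y, x). {y..x}) (range_endpoints f)"
    unfolding disjoint_family_on_def
  proof (intro ballI impI)
    fix p q assume "p \<in> range_endpoints f" "q \<in> range_endpoints f" and "p \<noteq> q"
    then obtain z z' where "p = (f z, right_adjoint f (f z))" "q = (f z', right_adjoint f (f z'))"
      by (auto simp: range_endpoints_def)
    \<comment> \<open>A common point \<open>w\<close> would give \<open>f z = f w = f z'\<close>,
      and hence \<open>p = q\<close>.\<close>
    with \<open>p \<noteq> q\<close> const[of _ z] const[of _ z']
    show "(case p of (y, x) \<Rightarrow> {y..x}) \<inter> (case q of (y, x) \<Rightarrow> {y..x}) = {}"
      by (metis (no_types, lifting) case_prod_conv disjoint_iff)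
  qed
  moreover have "\<forall>(y, x)\<in>range_endpoints f. y \<le> x"
    by (auto simp: range_endpoints_def adj ff)
  ultimately show ?thesis
    by (simp add: emmentaler_endpoints_def fst_eq snd_eq)
qed

text \<open>The two adjoints agree at \<open>f z\<close>, and \<open>z\<close> lies below the
  adjoint of \<open>f\<close> there; the adjunction for \<open>g\<close> then bounds
  \<open>g z\<close>.\<close>

lemma range_endpoints_subset_imp_le:
  assumes "join_continuous f" "join_continuous g"
    and "range_endpoints f \<subseteq> range_endpoints g"
  shows "g z \<le> f z"
proof -
  have "(f z, right_adjoint f (f z)) \<in> range_endpoints g"
    using assms(3) by (auto simp: range_endpoints_def)
  then have "right_adjoint f (f z) = right_adjoint g (f z)"
    by (auto simp: range_endpoints_def)
  then show ?thesis
    by (metis le_right_adjoint_iff[OF assms(1)] le_right_adjoint_iff[OF assms(2)] order.refl)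
qed

section \<open>From emmentalers to idempotent maps\<close>

context
  fixes P :: "('a::complete_lattice \<times> 'a) set"
  assumes P: "emmentaler_endpoints P"
begin

lemma endpoints_le: "(y, x) \<in> P \<Longrightarrow> y \<le> x"
  using P unfolding emmentaler_endpoints_def by blast

lemma endpoints_unique:
  assumes "(y, x) \<in> P" "(y', x') \<in> P" "z \<in> {y..x}" "z \<in> {y'..x'}"
  shows "y = y' \<and> x = x'"
proof -
  have "disjoint_family_on (\<lambda>(y, x). {y..x}) P"
    using P unfolding emmentaler_endpoints_def by blast
  from disjoint_family_onD[OF this assms(1,2)] assms(3,4)
  have "(y, x) = (y', x')"
    by (metis case_prod_conv disjoint_iff)
  then show ?thesis
    by simp
qed

lemma Sup_lower_endpoints: "S \<subseteq> fst ` P \<Longrightarrow> Sup S \<in> fst ` P"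
  using P unfolding emmentaler_endpoints_def by blast

lemma Inf_upper_endpoints: "S \<subseteq> snd ` P \<Longrightarrow> Inf S \<in> snd ` P"
  using P unfolding emmentaler_endpoints_def by blast

text \<open>If \<open>y \<le> x'\<close>, then \<open>sup y y'\<close> is a lower endpoint lying in
  \<open>{y'..x'}\<close>, so disjointness forces it to be \<open>y'\<close>.\<close>

lemma lower_le_lower_iff_le_upper:
  assumes "(y, x) \<in> P" "(y', x') \<in> P"
  shows "y \<le> y' \<longleftrightarrow> y \<le> x'"
proof
  assume "y \<le> x'"
  have "Sup {y, y'} \<in> fst ` P"
    using assms by (intro Sup_lower_endpoints) force
  then obtain x'' where P'': "(sup y y', x'') \<in> P"
    by force
  have "sup y y' = y' \<and> x'' = x'"
    using \<open>y \<le> x'\<close> endpoints_le[OF assms(2)] endpoints_le[OF P'']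
    by (intro endpoints_unique[OF P'' assms(2), of "sup y y'"]) auto
  then show "y \<le> y'"
    by (simp add: le_iff_sup)
qed (use endpoints_le[OF assms(2)] in auto)

text \<open>Dually, \<open>inf x x'\<close> is an upper endpoint lying in \<open>{y..x}\<close>, so
  it must be \<open>x\<close>.\<close>

lemma upper_le_upper_iff_lower_le_upper:
  assumes "(y, x) \<in> P" "(y', x') \<in> P"
  shows "x \<le> x' \<longleftrightarrow> y \<le> x'"
proof
  assume "y \<le> x'"
  have "Inf {x, x'} \<in> snd ` P"
    using assms by (intro Inf_upper_endpoints) force
  then obtain y'' where P'': "(y'', inf x x') \<in> P"
    by force
  have "y'' = y \<and> inf x x' = x"
    using \<open>y \<le> x'\<close> endpoints_le[OF assms(1)] endpoints_le[OF P'']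
    by (intro endpoints_unique[OF P'' assms(1), of "inf x x'"]) auto
  then show "x \<le> x'"
    by (simp add: le_iff_inf)
qed (use endpoints_le[OF assms(1)] in auto)

lemma ex_left_adjoint:
  obtains f where "\<And>z. f z \<in> fst ` P" "\<And>z y x. (y, x) \<in> P \<Longrightarrow> f z \<le> y \<longleftrightarrow> z \<le> x"
proof -
  have "\<exists>a \<in> fst ` P. \<forall>(y, x)\<in>P. a \<le> y \<longleftrightarrow> z \<le> x" for z
  proof -
    define b where "b = Inf {x \<in> snd ` P. z \<le> x}"
    have "b \<in> snd ` P"
      unfolding b_def by (rule Inf_upper_endpoints) auto
    then obtain a where ab: "(a, b) \<in> P"
      by force
    have "z \<le> b"
      by (auto simp: b_def intro: Inf_greatest)
    have "a \<le> y \<longleftrightarrow> z \<le> x" if "(y, x) \<in> P" for y x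
    proof -
      \<comment> \<open>Unlike \<open>z\<close>, the element \<open>b\<close> is an endpoint, so the
        comparison lemmas apply to it; it remains to see that \<open>b\<close> and \<open>z\<close>
        lie below the same upper endpoints.\<close>
      have "a \<le> y \<longleftrightarrow> b \<le> x"
        using lower_le_lower_iff_le_upper[OF ab that] upper_le_upper_iff_lower_le_upper[OF ab that]
        by simp
      also have "\<dots> \<longleftrightarrow> z \<le> x"
      proof
        show "z \<le> x" if "b \<le> x"
          using \<open>z \<le> b\<close> that by (rule order.trans)
        show "b \<le> x" if "z \<le> x"
          unfolding b_def using \<open>(y, x) \<in> P\<close> that by (intro Inf_lower) force
      qed
      finally show ?thesis .
    qed
    then show ?thesis
      using ab by (intro bexI[of _ a]) (auto simp: image_iff intro!: bexI[of _ "(a, b)"])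
  qed
  then obtain f where "\<And>z. f z \<in> fst ` P \<and> (\<forall>(y, x)\<in>P. f z \<le> y \<longleftrightarrow> z \<le> x)"
    by metis
  then show ?thesis
    by (intro that[of f]) auto
qed

lemma ex_idempotent_join_continuous:
  obtains f where "join_continuous f" "f \<circ> f = f" "range_endpoints f = P"
proof -
  obtain f where f_in: "\<And>z. f z \<in> fst ` P"
    and f_le: "\<And>z y x. (y, x) \<in> P \<Longrightarrow> f z \<le> y \<longleftrightarrow> z \<le> x"
    using ex_left_adjoint by blast
  \<comment> \<open>The defining property of \<open>f\<close> only tests \<open>f z\<close> against
    lower endpoints; between two lower endpoints these tests suffice for equality.\<close>
  have lower_eqI: "a = b"
    if "a \<in> fst ` P" "b \<in> fst ` P" "\<And>y x. (y, x) \<in> P \<Longrightarrow> a \<le> y \<longleftrightarrow> b \<le> y" for a b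
  proof -
    obtain x x' where "(a, x) \<in> P" "(b, x') \<in> P"
      using \<open>a \<in> fst ` P\<close> \<open>b \<in> fst ` P\<close> by auto
    then show ?thesis
      using that(3) by (metis order.antisym order.refl)
  qed
  have "f (Sup X) = Sup (f ` X)" for X
  proof (rule lower_eqI)
    show "Sup (f ` X) \<in> fst ` P"
      using f_in by (intro Sup_lower_endpoints) auto
    show "f (Sup X) \<le> y \<longleftrightarrow> Sup (f ` X) \<le> y" if "(y, x) \<in> P" for y x
      by (simp add: f_le[OF that] Sup_le_iff)
  qed (rule f_in)
  then have jc: "join_continuous f"
    by (simp add: join_continuous_def)
  \<comment> \<open>For any other pair, \<open>f y \<le> y'\<close> means \<open>y \<le> x'\<close>,
    which by the comparison of endpoints means \<open>y \<le> y'\<close>.\<close>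
  have fix_lower: "f y = y" if "(y, x) \<in> P" for y x
  proof (rule lower_eqI)
    show "y \<in> fst ` P"
      using that by force
    show "f y \<le> y' \<longleftrightarrow> y \<le> y'" if "(y', x') \<in> P" for y' x'
      using f_le[OF that] lower_le_lower_iff_le_upper[OF \<open>(y, x) \<in> P\<close> that] by simp
  qed (rule f_in)
  then have "f (f z) = f z" for z
    using f_in[of z] by force
  then have "f \<circ> f = f"
    by auto
  \<comment> \<open>The set whose join is taken is exactly \<open>{..x}\<close>.\<close>
  moreover have upper: "right_adjoint f y = x" if "(y, x) \<in> P" for y x
    by (simp add: right_adjoint_def f_le[OF that] flip: atMost_def)
  have "range_endpoints f = P"
  proof
    show "range_endpoints f \<subseteq> P"
    proof
      fix p assume "p \<in> range_endpoints f"
      then obtain z where p: "p = (f z, right_adjoint f (f z))"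
        by (auto simp: range_endpoints_def)
      obtain x where "(f z, x) \<in> P"
        using f_in[of z] by force
      then show "p \<in> P"
        using upper p by simp
    qed
    show "P \<subseteq> range_endpoints f"
    proof (rule subrelI)
      fix y x assume yx: "(y, x) \<in> P"
      have "(f y, right_adjoint f (f y)) \<in> range_endpoints f"
        by (simp add: range_endpoints_def)
      then show "(y, x) \<in> range_endpoints f"
        using fix_lower[OF yx] upper[OF yx] by simp
    qed
  qed
  ultimately show ?thesis
    using jc that by blast
qed

end

theorem theorem1:
  "\<exists>\<phi>. bij_betw \<phi> {f :: 'a::complete_lattice \<Rightarrow> 'a. join_continuous f \<and> f \<circ> f = f}
                  {E :: 'a set set. emmentaler E}"
proof -
  define \<phi> where "\<phi> f = (\<lambda>(y, x). {y..x}) ` range_endpoints f" for f :: "'a \<Rightarrow> 'a"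
  let ?F = "{f :: 'a \<Rightarrow> 'a. join_continuous f \<and> f \<circ> f = f}"
  \<comment> \<open>Stated as an inequality so that exchanging \<open>f\<close> and \<open>g\<close>
    yields equality by antisymmetry.\<close>
  have \<phi>_le: "g z \<le> f z" if "f \<in> ?F" "g \<in> ?F" "\<phi> f = \<phi> g" for f g z
  proof (rule range_endpoints_subset_imp_le[of f g])
    have "emmentaler_endpoints (range_endpoints f)"
      using that(1) emmentaler_endpoints_range_endpoints by blast
    then show "range_endpoints f \<subseteq> range_endpoints g"
      using interval_image_eq_imp_subset[OF that(3)[unfolded \<phi>_def]] endpoints_le by blast
  qed (use that in auto)
  have "inj_on \<phi> ?F"
  proof (rule inj_onI, rule ext)
    fix f g z assume "f \<in> ?F" "g \<in> ?F" "\<phi> f = \<phi> g"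
    then show "f z = g z"
      using \<phi>_le[of f g z] \<phi>_le[of g f z] by simp
  qed
  moreover have "\<phi> ` ?F = {E. emmentaler E}"
  proof
    show "\<phi> ` ?F \<subseteq> {E. emmentaler E}"
      using emmentaler_endpoints_range_endpoints
      by (auto simp: \<phi>_def emmentaler_iff_endpoints)
    show "{E. emmentaler E} \<subseteq> \<phi> ` ?F"
    proof
      fix E :: "'a set set" assume "E \<in> {E. emmentaler E}"
      then obtain P where E: "E = (\<lambda>(y, x). {y..x}) ` P" and P: "emmentaler_endpoints P"
        by (auto simp: emmentaler_iff_endpoints)
      obtain f where "join_continuous f" "f \<circ> f = f" "range_endpoints f = P"
        using ex_idempotent_join_continuous[OF P] by blast
      then show "E \<in> \<phi> ` ?F"
        by (auto simp: \<phi>_def E)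
    qed
  qed
  ultimately show ?thesis
    unfolding bij_betw_def by blast
qed

end
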